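(* Let $A=(a_{ij}) \in \mathbb{R}^{m \times r}$ and $B=(b_{ji}) \in \mathbb{R}^{r \times n}$ with $B$ of full rank $n$. The following are equivalent: (i) for all $\kappa \in \mathbb{R}^r_+$ and $y \in \mathbb{R}^m$, the system $\sum_{j=1}^r a_{ij}\, \kappa_j\, x_1^{b_{j1}} \cdots x_n^{b_{jn}} = y_i$, $i = 1, \dots, m$, has at most one solution $x \in \mathbb{R}^n_+$; (ii) $\sigma(\ker(A)) \cap \sigma(\mathrm{im}(B)) = \{0\}$.
   Context: $\mathbb{R}_+$ denotes the strictly positive reals; exponents are arbitrary reals. $\sigma$ is the componentwise sign vector in $\{-,0,+\}^r$, $\sigma(T)=\{\sigma(x)\mid x\in T\}$, and $0$ denotes the zero sign vector. *)

theory Defs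
  imports "HOL-Analysis.Analysis"
begin

text \<open>Componentwise sign vector, with values in {-1,0,1} (encoding {-,0,+}).\<close>
definition sign_vec :: "real^'r \<Rightarrow> real^'r" where
  "sign_vec x = (\<chi> j. sgn (x $ j))"

definition mat_ker :: "real^'r^'m \<Rightarrow> (real^'r) set" where
  "mat_ker A = {x. A *v x = 0}"

definition mat_im :: "real^'n^'r \<Rightarrow> (real^'r) set" where
  "mat_im B = range (\<lambda>z. B *v z)"

text \<open>Generalized polynomial map: component i is
  sum_j a_ij kappa_j x_1^(b_j1) ... x_n^(b_jn).\<close>
definition gen_poly_map :: "real^'r^'m \<Rightarrow> real^'n^'r \<Rightarrow> real^'r \<Rightarrow> real^'n \<Rightarrow> real^'m" where
  "gen_poly_map A B \<kappa> x = (\<chi> i. \<Sum>j\<in>UNIV. A $ i $ j * \<kappa> $ j * (\<Prod>k\<in>UNIV. (x $ k) powr (B $ j $ k)))"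

definition pos_vec :: "real^'n \<Rightarrow> bool" where
  "pos_vec x \<longleftrightarrow> (\<forall>k. x $ k > 0)"

end

theory Submission
  imports Defs
begin

text \<open>On positive vectors the generalized polynomial map factors as
  \<open>x \<mapsto> B *v ln x \<mapsto> A *v (\<kappa> * exp (\<dots>))\<close>. Since \<open>\<kappa>\<close> is positive and \<open>exp\<close> is strictly
  increasing, the difference of the images of two points under the second step has the sign
  vector of \<open>B *v (ln x - ln x')\<close>, and it lies in \<open>ker A\<close> when the two points collide; with
  \<open>B\<close> injective this gives uniqueness. Conversely, any \<open>v \<in> ker A\<close> sharing its sign vector with
  \<open>B *v w\<close> equals \<open>\<kappa> * (exp (B *v w) - 1)\<close> for a suitable positive \<open>\<kappa>\<close>, so \<open>exp w\<close> and \<open>1\<close>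
  collide.\<close>

definition vec_exp :: "real^'n \<Rightarrow> real^'n" where
  "vec_exp u = (\<chi> k. exp (u $ k))"

definition vec_ln :: "real^'n \<Rightarrow> real^'n" where
  "vec_ln x = (\<chi> k. ln (x $ k))"

lemma vec_ln_vec_exp [simp]: "vec_ln (vec_exp u) = u"
  by (simp add: vec_ln_def vec_exp_def vec_eq_iff)

lemma vec_exp_zero: "vec_exp 0 = 1"
  by (simp add: vec_exp_def vec_eq_iff)

lemma pos_vec_vec_exp: "pos_vec (vec_exp u)"
  by (simp add: pos_vec_def vec_exp_def)

lemma vec_ln_inj_on_pos:
  assumes "pos_vec x" "pos_vec x'" "vec_ln x = vec_ln x'"
  shows "x = x'"
  using assms unfolding vec_ln_def pos_vec_def vec_eq_iff by simp

lemma sign_vec_zero [simp]: "sign_vec 0 = 0"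
  by (simp add: sign_vec_def vec_eq_iff)

lemma sign_vec_eq_zero_iff: "sign_vec x = 0 \<longleftrightarrow> x = 0"
  by (simp add: sign_vec_def vec_eq_iff sgn_0_0)

lemma gen_poly_map_eq_exp:
  fixes A :: "real^'r^'m" and B :: "real^'n^'r"
  assumes "pos_vec x"
  shows "gen_poly_map A B \<kappa> x = A *v (\<kappa> * vec_exp (B *v vec_ln x))"
proof -
  have "(\<Prod>k\<in>UNIV. (x $ k) powr (B $ j $ k)) = exp ((B *v vec_ln x) $ j)" for j
  proof -
    have "(\<Prod>k\<in>UNIV. (x $ k) powr (B $ j $ k)) = (\<Prod>k\<in>UNIV. exp (B $ j $ k * ln (x $ k)))"
      using assms by (intro prod.cong) (auto simp: pos_vec_def powr_def less_imp_neq[symmetric])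
    also have "\<dots> = exp (\<Sum>k\<in>UNIV. B $ j $ k * ln (x $ k))"
      by (simp add: exp_sum)
    finally show ?thesis
      by (simp add: matrix_vector_mult_def vec_ln_def)
  qed
  then show ?thesis
    by (simp add: gen_poly_map_def matrix_vector_mult_def vec_exp_def mult.assoc)
qed

lemma sgn_exp_diff: "sgn (exp a - exp b) = sgn (a - b :: real)"
  by (cases a b rule: linorder_cases) auto

lemma sign_vec_scaled_exp_diff:
  assumes "pos_vec \<kappa>"
  shows "sign_vec (\<kappa> * (vec_exp u - vec_exp u')) = sign_vec (u - u')"
  using assms
  by (simp add: sign_vec_def vec_eq_iff vec_exp_def pos_vec_def sgn_mult sgn_exp_diff)

lemma scaled_exp_diff_realizes_sign:
  assumes "sign_vec v = sign_vec u"
  obtains \<kappa> where "pos_vec \<kappa>" and "\<kappa> * (vec_exp u - 1) = v"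
proof
  have sg: "sgn (v $ j) = sgn (exp (u $ j) - 1)" for j
    using assms sgn_exp_diff[of "u $ j" 0] by (simp add: sign_vec_def vec_eq_iff)
  define \<kappa> :: "real^'a" where
    "\<kappa> = (\<chi> j. if u $ j = 0 then 1 else v $ j / (exp (u $ j) - 1))"
  have "\<kappa> $ j > 0" for j
  proof (cases "u $ j = 0")
    case False
    then have "sgn (v $ j) = sgn (exp (u $ j) - 1)" "exp (u $ j) - 1 \<noteq> 0"
      using sg by auto
    then show ?thesis
      using False by (auto simp: \<kappa>_def sgn_if divide_neg_neg split: if_splits)
  qed (simp add: \<kappa>_def)
  then show "pos_vec \<kappa>"
    by (simp add: pos_vec_def)
  show "\<kappa> * (vec_exp u - 1) = v"
    unfolding vec_eq_iff
  proof
    fix j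
    show "(\<kappa> * (vec_exp u - 1)) $ j = v $ j"
      using sg[of j] by (cases "u $ j = 0") (auto simp: \<kappa>_def vec_exp_def sgn_0_0)
  qed
qed

lemma gen_poly_map_inj_on_pos:
  fixes A :: "real^'r^'m" and B :: "real^'n^'r"
  assumes "inj ((*v) B)" and signs: "sign_vec ` mat_ker A \<inter> sign_vec ` mat_im B = {0}"
    and "pos_vec \<kappa>" "pos_vec x" "pos_vec x'"
    and eq: "gen_poly_map A B \<kappa> x = gen_poly_map A B \<kappa> x'"
  shows "x = x'"
proof -
  define v where "v = \<kappa> * (vec_exp (B *v vec_ln x) - vec_exp (B *v vec_ln x'))"
  have "v \<in> mat_ker A"
    using eq by (simp add: mat_ker_def v_def gen_poly_map_eq_exp assms(4,5) algebra_simps)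
  moreover have "sign_vec v = sign_vec (B *v (vec_ln x - vec_ln x'))"
    using \<open>pos_vec \<kappa>\<close> by (simp add: v_def sign_vec_scaled_exp_diff matrix_vector_mult_diff_distrib)
  moreover have "B *v (vec_ln x - vec_ln x') \<in> mat_im B"
    by (simp add: mat_im_def)
  ultimately have "sign_vec (B *v (vec_ln x - vec_ln x')) = 0"
    using signs by (metis IntI image_eqI singletonD)
  then have "B *v (vec_ln x - vec_ln x') = B *v 0"
    by (simp add: sign_vec_eq_zero_iff)
  then have "vec_ln x = vec_ln x'"
    using \<open>inj ((*v) B)\<close> by (metis injD eq_iff_diff_eq_0)
  then show ?thesis
    using vec_ln_inj_on_pos assms(4,5) by blast
qed

lemma gen_poly_map_collision:
  fixes A :: "real^'r^'m" and B :: "real^'n^'r"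
  assumes "v \<in> mat_ker A" and "sign_vec v = sign_vec (B *v w)"
  obtains \<kappa> where "pos_vec \<kappa>"
    and "gen_poly_map A B \<kappa> (vec_exp w) = gen_poly_map A B \<kappa> (vec_exp 0)"
proof -
  obtain \<kappa> where "pos_vec \<kappa>" and \<kappa>: "\<kappa> * (vec_exp (B *v w) - 1) = v"
    using scaled_exp_diff_realizes_sign assms(2) by blast
  have "gen_poly_map A B \<kappa> (vec_exp w) - gen_poly_map A B \<kappa> (vec_exp 0) = A *v v"
    unfolding gen_poly_map_eq_exp[OF pos_vec_vec_exp] vec_ln_vec_exp
    by (simp add: vec_exp_zero \<kappa>[symmetric] algebra_simps)
  then show ?thesis
    using that \<open>pos_vec \<kappa>\<close> assms(1) by (simp add: mat_ker_def)
qed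

lemma sign_vec_ker_inter_im_trivial:
  fixes A :: "real^'r^'m" and B :: "real^'n^'r"
  assumes uniq: "\<And>\<kappa> x x'. pos_vec \<kappa> \<Longrightarrow> pos_vec x \<Longrightarrow> pos_vec x' \<Longrightarrow>
      gen_poly_map A B \<kappa> x = gen_poly_map A B \<kappa> x' \<Longrightarrow> x = x'"
    and s: "s \<in> sign_vec ` mat_ker A \<inter> sign_vec ` mat_im B"
  shows "s = 0"
proof -
  obtain v where v: "v \<in> mat_ker A" "s = sign_vec v"
    using s by blast
  obtain w where w: "s = sign_vec (B *v w)"
    using s by (auto simp: mat_im_def)
  obtain \<kappa> where "pos_vec \<kappa>"
    and "gen_poly_map A B \<kappa> (vec_exp w) = gen_poly_map A B \<kappa> (vec_exp 0)"
    using gen_poly_map_collision[of v A B w] v w by auto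
  then have "vec_exp w = vec_exp 0"
    using uniq pos_vec_vec_exp by blast
  then have "w = 0"
    by (metis vec_ln_vec_exp)
  then show "s = 0"
    using w by simp
qed

theorem mainTheorem19:
  fixes A :: "real^'r^'m" and B :: "real^'n^'r"
  assumes "rank B = CARD('n)"
  shows "(\<forall>\<kappa> y. pos_vec \<kappa> \<longrightarrow>
            (\<forall>x x'. pos_vec x \<and> pos_vec x' \<and> gen_poly_map A B \<kappa> x = y \<and> gen_poly_map A B \<kappa> x' = y
                \<longrightarrow> x = x'))
     \<longleftrightarrow> (sign_vec ` mat_ker A \<inter> sign_vec ` mat_im B = {0})"
    (is "?unique \<longleftrightarrow> ?signs")
proof
  assume ?unique
  then have "s = 0" if "s \<in> sign_vec ` mat_ker A \<inter> sign_vec ` mat_im B" for s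
    using sign_vec_ker_inter_im_trivial that by blast
  moreover have "0 \<in> mat_ker A" "0 \<in> mat_im B"
    using rangeI[of "(*v) B" 0] by (simp_all add: mat_ker_def mat_im_def)
  then have "0 \<in> sign_vec ` mat_ker A \<inter> sign_vec ` mat_im B"
    by (auto intro!: image_eqI[where x = 0])
  ultimately show ?signs
    by blast
next
  assume ?signs
  moreover have "inj ((*v) B)"
    using assms full_rank_injective by blast
  ultimately show ?unique
    using gen_poly_map_inj_on_pos by blast
qed

end
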